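(* Let $K$ be a field in which $2\neq 0$, let $\lambda\in K\setminus\{0,1\}$, and let $E$ be the Legendre elliptic curve over $K$ given by $y^2=x(x+1)(x+\lambda)$. Let $n\geq 4$ be any even integer not divisible by the characteristic of $K$. Then there exists a radical extension $K'$ of $K$ over which $E$ has $n$ (distinct) $K'$-rational points.
   Context: A radical extension of $K$ is a finite extension $K'/K$ admitting a tower $K=K_0\subset K_1\subset\cdots\subset K_r=K'$ with $K_{i+1}=K_i(a_i)$ where $a_i^{m_i}\in K_i$ for some integer $m_i\geq 1$. If $K$ has characteristic $0$, every integer $n\ge 4$ counts as not divisible by the characteristic. The assertion is that $E(K')$ contains at least $n$ points. *)

theory Defs
  imports "HOL-Algebra.Algebraic_Closure_Type" "HOL-Algebra.Generated_Fields"
begin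

text \<open>
  Extensions of a base field are formed inside an ambient field, given as a type \<open>'b\<close> of class
  \<open>field\<close>. To use the library's notions of subfield, generated field and finite dimension,
  the type is turned into a ring record by \<open>ring_of_type_algebra\<close>.
\<close>

abbreviation ambient :: "'b::field ring"
  where "ambient \<equiv> ring_of_type_algebra"

definition radical_extension :: "'b::field set \<Rightarrow> 'b set \<Rightarrow> bool"
  where "radical_extension K K' \<longleftrightarrow>
    subfield K ambient \<and> subfield K' ambient \<and> K \<subseteq> K' \<and>
    ring.finite_dimension ambient K K' \<and>
    (\<exists>(r::nat) (T::nat \<Rightarrow> 'b set) (a::nat \<Rightarrow> 'b) (m::nat \<Rightarrow> nat).
       T 0 = K \<and> T r = K' \<and>
       (\<forall>i<r. m i \<ge> 1 \<and> a i ^ m i \<in> T i \<and>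
              T (Suc i) = generate_field ambient (insert (a i) (T i))))"

text \<open>
  A plane cubic in Weierstrass form has exactly one point on the line at infinity, \<open>[0 : 1 : 0]\<close>,
  and it is rational over every field.
\<close>

datatype 'b curve_point = Infinity | Affine 'b 'b

definition legendre_points :: "'b::field \<Rightarrow> 'b set \<Rightarrow> 'b curve_point set"
  where "legendre_points l F =
    insert Infinity {Affine x y | x y. x \<in> F \<and> y \<in> F \<and> y ^ 2 = x * (x + 1) * (x + l)}"

end

theory Submission
  imports Defs
begin

text \<open>
  Any supply of \<open>n\<close> distinct abscissae that are radical over \<open>K\<close> suffices, because an ordinate over
  \<open>x\<close> is a square root of \<open>x(x+1)(x+\<lambda>)\<close>. The \<open>n\<close>-th roots of unity are such a supply: since the
  characteristic does not divide \<open>n\<close>, there are \<open>n\<close> of them. No group law is involved.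
\<close>

lemma ambient_simps [simp]:
  "carrier ambient = UNIV" "\<one>\<^bsub>ambient\<^esub> = 1" "\<zero>\<^bsub>ambient\<^esub> = 0"
  "x \<otimes>\<^bsub>ambient\<^esub> y = x * y" "x \<oplus>\<^bsub>ambient\<^esub> y = x + y"
  by (simp_all add: ring_of_type_algebra_def)

context
begin

interpretation ambient: field "ambient :: 'b::field ring"
  by (rule field_from_type_algebra)

lemma ambient_a_inv [simp]: "\<ominus>\<^bsub>ambient\<^esub> x = - (x :: 'b::field)"
  using ambient.minus_equality[of "- x" x] by simp

lemma ambient_m_inv [simp]: "x \<noteq> 0 \<Longrightarrow> inv\<^bsub>ambient\<^esub> x = inverse (x :: 'b::field)"
  using ambient.inv_unique'[of x "inverse x"] by simp

lemma ambient_pow [simp]: "x [^]\<^bsub>ambient\<^esub> (n::nat) = (x :: 'b::field) ^ n"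
  by (induction n) (simp_all add: mult.commute)

lemma subfield_range_to_ac: "subfield (range to_ac) (ambient :: 'k::field alg_closure ring)"
proof (rule ambient.subfieldI')
  show "subring (range to_ac) (ambient :: 'k alg_closure ring)"
    by (rule ambient.subringI)
      (auto simp flip: to_ac_1 to_ac_minus to_ac_add to_ac_mult)
  show "inv\<^bsub>ambient\<^esub> k \<in> range to_ac" if "k \<in> range to_ac - {\<zero>\<^bsub>ambient\<^esub>}" for k :: "'k alg_closure"
    using that by (auto simp flip: to_ac_inverse)
qed

text \<open>The polynomials X^m and the constant a^m have coefficients in \<open>K\<close>, differ
  because m >= 1, and agree at \<open>a\<close>. So evaluation at \<open>a\<close> is not injective,
  which is the negation of transcendence.\<close>

lemma algebraic_of_power_mem:
  fixes a :: "'b::field"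
  assumes K: "subfield K ambient" and m: "m \<ge> 1" and am: "a ^ m \<in> K"
  shows "(ambient.algebraic over K) a"
\<comment> \<open>Polynomials are coefficient lists with nonzero leading entry, so
  \<open>[a ^ m]\<close> is a legitimate constant only for nonzero \<open>a\<close>.\<close>
proof (cases "a = 0")
  case True
  then show ?thesis
    using ambient.zero_is_algebraic[OF subfieldE(1)[OF K]] by (simp add: over_def)
next
  case False
  note sr = subfieldE(1)[OF K]
  have p: "ambient.monom 1 m \<in> carrier (K [X]\<^bsub>ambient\<^esub>)"
    using ambient.monom_is_polynomial[OF sr, of 1 m] subringE(3)[OF sr]
    by (simp add: univ_poly_carrier)
  have q: "[a ^ m] \<in> carrier (K [X]\<^bsub>ambient\<^esub>)"
    using am False by (simp add: polynomial_def flip: univ_poly_carrier)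
  have "ambient.monom 1 m \<noteq> [a ^ m]"
    using m by (simp add: ambient.monom_def)
  moreover have "ambient.eval (ambient.monom 1 m) a = ambient.eval [a ^ m] a"
    by (simp add: ambient.eval_monom)
  ultimately show ?thesis
    using inj_onD[OF _ _ p q] unfolding over_def ambient.transcendental_def by blast
qed

text \<open>Links polynomial expressions in \<open>a\<close>, for which finite dimension is known,
  to the generated field used in the towers. For algebraic \<open>a\<close> these expressions
  already form a field, and every subfield containing \<open>a\<close> and \<open>K\<close> contains
  them.\<close>

lemma simple_extension_eq_generate_field:
  fixes a :: "'b::field"
  assumes K: "subfield K ambient" and alg: "(ambient.algebraic over K) a"
  shows "ambient.simple_extension K a = generate_field ambient (insert a K)"
proof (rule ambient.generate_fieldI)
  show "subfield (ambient.simple_extension K a) ambient"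
    using ambient.simple_extension_is_subfield[OF K] alg by simp
  show "insert a K \<subseteq> ambient.simple_extension K a"
    using ambient.simple_extension_incl[of K a] ambient.simple_extension_mem[OF subfieldE(1)[OF K]]
    by simp
  show "ambient.simple_extension K a \<subseteq> L" if "subfield L ambient" "insert a K \<subseteq> L" for L
    using ambient.simple_extension_subring_incl[OF subfieldE(1)[OF that(1)], of K a] that(2) by simp
qed simp

lemma radical_extension_refl:
  fixes K :: "'b::field set"
  assumes "subfield K ambient"
  shows "radical_extension K K"
proof -
  have "ambient.finite_dimension K K"
    using ambient.dimension_one[OF assms] by (rule ambient.finite_dimensionI)
  moreover have "\<exists>(r::nat) T (a::nat \<Rightarrow> 'b) (m::nat \<Rightarrow> nat). T 0 = K \<and> T r = K \<and>
      (\<forall>i<r. m i \<ge> 1 \<and> a i ^ m i \<in> T i \<and> T (Suc i) = generate_field ambient (insert (a i) (T i)))"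
    by (rule exI[of _ 0]) auto
  ultimately show ?thesis
    using assms by (simp add: radical_extension_def)
qed

text \<open>One more radical step lengthens the tower by one; finiteness over \<open>K\<close>
  follows from the multiplicativity of dimension.\<close>

lemma radical_extension_adjoin:
  fixes a :: "'b::field"
  assumes F: "radical_extension K F" and m: "m \<ge> 1" and am: "a ^ m \<in> F"
  shows "radical_extension K (generate_field ambient (insert a F))"
proof -
  let ?G = "generate_field ambient (insert a F)"
  from F obtain r T b k
    where sub: "subfield K ambient" "subfield F ambient" and KF: "K \<subseteq> F"
      and fin: "ambient.finite_dimension K F"
      and T: "T 0 = K" "T r = F"
      and step: "\<forall>i<r. k i \<ge> 1 \<and> b i ^ k i \<in> T i \<and>
        T (Suc i) = generate_field ambient (insert (b i) (T i))"
    unfolding radical_extension_def by blast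
  have alg: "(ambient.algebraic over F) a"
    using sub(2) m am by (rule algebraic_of_power_mem)
  have "ambient.finite_dimension F ?G"
    using ambient.finite_dimension_simple_extension[OF sub(2), of a] alg
      simple_extension_eq_generate_field[OF sub(2) alg] by simp
  then have "ambient.finite_dimension K ?G"
    by (rule ambient.telescopic_base_dim(1)[OF sub fin])
  moreover have "subfield ?G ambient"
    by (rule ambient.generate_field_is_subfield) simp
  moreover have "K \<subseteq> ?G"
    using KF by (auto intro: generate_field.incl)
  \<comment> \<open>The new field sits at index \<open>Suc r\<close>, its generator and exponent at
    index \<open>r\<close>; the fields up to \<open>T r = F\<close> stay as they were.\<close>
  moreover have "\<forall>i<Suc r. (k(r := m)) i \<ge> 1 \<and> (b(r := a)) i ^ (k(r := m)) i \<in> (T(Suc r := ?G)) i \<and>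
      (T(Suc r := ?G)) (Suc i) = generate_field ambient (insert ((b(r := a)) i) ((T(Suc r := ?G)) i))"
    using step T m am by (auto simp: less_Suc_eq)
  moreover have "(T(Suc r := ?G)) 0 = K" "(T(Suc r := ?G)) (Suc r) = ?G"
    using T by simp_all
  ultimately show ?thesis
    unfolding radical_extension_def using sub(1) by blast
qed

text \<open>The elements are adjoined one at a time: a power lying in \<open>F\<close> still lies in
  every larger field reached on the way.\<close>

lemma radical_extension_adjoin_finite:
  fixes A :: "'b::field set"
  assumes "finite A" and F: "radical_extension K F"
    and "\<And>a. a \<in> A \<Longrightarrow> \<exists>m\<ge>1. a ^ m \<in> F"
  obtains F' where "radical_extension K F'" "F \<subseteq> F'" "A \<subseteq> F'"
proof -
  have "\<exists>F'. radical_extension K F' \<and> F \<subseteq> F' \<and> A \<subseteq> F'"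
    using assms(1,3)
  proof (induction A rule: finite_induct)
    case empty
    then show ?case using F by blast
  next
    case (insert a A)
    then obtain F' where F': "radical_extension K F'" "F \<subseteq> F'" "A \<subseteq> F'"
      by blast
    obtain m where "m \<ge> 1" "a ^ m \<in> F'"
      using insert.prems F'(2) by blast
    then have "radical_extension K (generate_field ambient (insert a F'))"
      by (rule radical_extension_adjoin[OF F'(1)])
    moreover have "insert a F' \<subseteq> generate_field ambient (insert a F')"
      by (auto intro: generate_field.incl)
    ultimately show ?case
      using F'(2,3) by blast
  qed
  then show thesis using that by blast
qed

end

text \<open>X^n - 1 splits into n linear factors. A repeated root would also be a root of the
  derivative n X^(n-1), which can vanish only at 0, and 0 is not a root of X^n - 1.\<close>

lemma card_roots_of_unity:
  assumes n: "of_nat n \<noteq> (0 :: 'a::alg_closed_field)"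
  shows "card {z :: 'a. z ^ n = 1} = n"
proof -
  define p :: "'a poly" where "p = Polynomial.monom 1 n - 1"
  have n0: "n > 0"
    using n by (auto intro!: Nat.gr0I)
  have roots: "poly p z = 0 \<longleftrightarrow> z ^ n = 1" for z
    by (simp add: p_def poly_monom)
  have "Polynomial.coeff p n = 1"
    using n0 by (simp add: p_def)
  then have p0: "p \<noteq> 0"
    by auto
  have deg: "Polynomial.degree p = n"
    using n0 Polynomial.degree_add_eq_left[of "- 1" "Polynomial.monom (1::'a) n"]
    by (simp add: p_def Polynomial.degree_monom_eq)
  obtain A c where A: "size A = Polynomial.degree p"
    and p_eq: "p = Polynomial.smult c (\<Prod>x\<in>#A. [:-x, 1:])"
    using alg_closed_imp_factorization[OF p0] by blast
  have "count A x \<le> 1" for x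
  proof (rule ccontr)
    assume "\<not> count A x \<le> 1"
    then have "{#x, x#} \<subseteq># A"
      by (simp add: subseteq_mset_def)
    then obtain B where B: "A = {#x, x#} + B"
      by (metis subset_mset.le_iff_add)
    define q where "q = Polynomial.smult c (\<Prod>x\<in>#B. [:-x, 1:])"
    \<comment> \<open>The linear factors are kept unexpanded, so that after the product rule every
      summand of the derivative visibly vanishes at \<open>x\<close>.\<close>
    have q: "p = [:-x, 1:] * ([:-x, 1:] * q)"
      by (simp add: p_eq B q_def mult_smult_right del: mult_pCons_left)
    have "poly p x = 0" and "poly (pderiv p) x = 0"
      unfolding q by (simp_all add: pderiv_mult del: mult_pCons_left)
    moreover have "pderiv p = Polynomial.monom (of_nat n) (n - 1)"
      by (simp add: p_def pderiv_diff pderiv_monom)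
    ultimately show False
      using n n0 by (auto simp: roots poly_monom power_0_left)
  qed
  moreover have set_A: "set_mset A = {z. z ^ n = 1}"
  proof -
    have "c \<noteq> 0"
      using p0 p_eq by auto
    then have "x \<in># A \<longleftrightarrow> poly p x = 0" for x
      unfolding p_eq by (auto simp: poly_prod_mset prod_mset_zero_iff)
    then show ?thesis by (auto simp: roots)
  qed
  ultimately have "count A x = 1" if "x \<in># A" for x
    using that by (metis count_greater_eq_one_iff le_antisym)
  then have "size A = card (set_mset A)"
    by (simp add: size_multiset_overloaded_eq)
  then show ?thesis
    using A deg set_A by simp
qed

theorem corollary2p12:
  fixes l :: "'k::field" and n :: nat
  assumes "(2::'k) \<noteq> 0"
    and "l \<noteq> 0" and "l \<noteq> 1"
    and "n \<ge> 4" and "even n" and "\<not> CHAR('k) dvd n"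
  shows "\<exists>K' :: 'k alg_closure set.
           radical_extension (range to_ac) K' \<and>
           (\<exists>P. P \<subseteq> legendre_points (to_ac l) K' \<and> finite P \<and> card P = n)"
proof -
  define Z where "Z = {z :: 'k alg_closure. z ^ n = 1}"
  define f where "f x = x * (x + 1) * (x + to_ac l)" for x
  \<comment> \<open>The algebraic closure has the same characteristic as K.\<close>
  have "of_nat n \<noteq> (0 :: 'k alg_closure)"
    using assms(6) by (simp add: of_nat_eq_0_iff_char_dvd)
  then have card_Z: "card Z = n"
    unfolding Z_def by (rule card_roots_of_unity)
  then have fin_Z: "finite Z"
    using assms(4) by (auto intro: card_ge_0_finite)
  have "\<exists>m\<ge>1. z ^ m \<in> range to_ac" if "z \<in> Z" for z
    using that assms(4) by (intro exI[of _ n]) (auto simp: Z_def simp flip: to_ac_1)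
  then obtain F where F: "radical_extension (range to_ac) F" "range to_ac \<subseteq> F" "Z \<subseteq> F"
    using radical_extension_adjoin_finite[OF fin_Z radical_extension_refl[OF subfield_range_to_ac]]
    by metis
  have "subring F ambient"
    using F(1) subfieldE(1) unfolding radical_extension_def by blast
  then have closed: "1 \<in> F" "x \<in> F \<Longrightarrow> y \<in> F \<Longrightarrow> x * y \<in> F" "x \<in> F \<Longrightarrow> y \<in> F \<Longrightarrow> x + y \<in> F" for x y
    using subringE(3,6,7)[of F ambient] by simp_all
  \<comment> \<open>The ordinates need a second stage: their squares lie in \<open>F\<close>, which
    contains the roots of unity, but not necessarily in K.\<close>
  have f_F: "f z \<in> F" if "z \<in> Z" for z
    unfolding f_def using that F(2,3) by (intro closed) auto
  have "\<forall>x. \<exists>y. y ^ 2 = f x"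
    by (simp add: nth_root_exists)
  then obtain s where s: "\<And>x. s x ^ 2 = f x"
    by metis
  have "\<exists>m\<ge>1. a ^ m \<in> F" if "a \<in> s ` Z" for a
    using that f_F s by (intro exI[of _ 2]) auto
  \<comment> \<open>Continuing the tower that ends in \<open>F\<close> makes \<open>F'\<close>
    radical over K itself, not just over \<open>F\<close>.\<close>
  then obtain F' where F': "radical_extension (range to_ac) F'" "F \<subseteq> F'" "s ` Z \<subseteq> F'"
    using radical_extension_adjoin_finite[OF finite_imageI[OF fin_Z] F(1)] by metis
  have "(\<lambda>z. Affine z (s z)) ` Z \<subseteq> legendre_points (to_ac l) F'"
    using subsetD[OF subset_trans[OF F(3) F'(2)]] subsetD[OF F'(3)] s
    by (auto simp: legendre_points_def f_def)
  \<comment> \<open>Distinct abscissae give distinct points, whatever square roots \<open>s\<close>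
    picks, even where an ordinate is 0.\<close>
  moreover have "card ((\<lambda>z. Affine z (s z)) ` Z) = n"
    using card_Z by (subst card_image) (auto intro: inj_onI)
  ultimately show ?thesis
    using F'(1) fin_Z by blast
qed

end
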